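(* Let $T$ be a finite group. There exists a natural number $n$ such that $T$ is a normalizer quotient of the symmetric group $S_n$, i.e. there exist a natural number $n$ and a subgroup $H\leq S_n$ such that $N_{S_n}(H)/H\cong T$.
   Context: $S_n$ denotes the symmetric group on $\{1,\ldots,n\}$, and $N_S(H)$ denotes the normalizer of a subgroup $H$ in a group $S$. A group $T$ is called a normalizer quotient of a group $S$ if there exists a subgroup $H\leq S$ such that $N_S(H)/H\cong T$. *)

theory Defs
  imports "HOL-Algebra.Sym_Groups" "HOL-Algebra.Group_Action"
begin

definition normalizer_quotient :: "('a, 'b) monoid_scheme \<Rightarrow> ('c, 'd) monoid_scheme \<Rightarrow> bool"
  where "normalizer_quotient T S \<longleftrightarrow>
    (\<exists>H. subgroup H S \<and> (S\<lparr>carrier := normalizer S H\<rparr> Mod H) \<cong> T)"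

end

theory Submission
  imports Defs
begin

text \<open>
  Let \<open>K\<close> be a large finite set and \<open>c\<close> an injective map from \<open>T\<close> to sizes between \<open>2\<close> and
  \<open>|K| / 2\<close>. The base group \<open>Sym(K)\<^sup>T\<close> acts coordinatewise on families of subsets of \<open>K\<close> indexed
  by \<open>T\<close>. As points, take the families with exactly one nonempty member, which is a singleton, and
  the families \<open>f\<close> such that for some \<open>t\<close> all \<open>f s\<close> have size \<open>c (t s)\<close>. A permutation of the
  points normalizing the base group maps singleton families to singleton families, so it induces a
  permutation \<open>\<sigma>\<close> of \<open>T\<close> and bijections \<open>K \<rightarrow> K\<close>. These determine it on all points, since points are
  separated by their stabilizers in the base group. Preservation of the size patterns forces \<open>\<sigma>\<close>
  to be a left translation of \<open>T\<close>, and all left translations occur, so the normalizer modulo the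
  base group is \<open>T\<close>.
\<close>

section \<open>Subsets and the transpositions preserving them\<close>

text \<open>Recovers a subset from its stabilizer, that is, from the transpositions preserving it: they
  determine it up to complement, and the size bound excludes the complement.\<close>
lemma eq_if_same_separation:
  assumes "B \<subseteq> K" "C \<subseteq> K" "finite K" "2 * card B < card K" "2 * card C < card K"
    and sep: "\<And>x y. x \<in> K \<Longrightarrow> y \<in> K \<Longrightarrow> (x \<in> B \<longleftrightarrow> y \<in> B) \<longleftrightarrow> (x \<in> C \<longleftrightarrow> y \<in> C)"
  shows "B = C"
proof (rule ccontr)
  assume "B \<noteq> C"
  then obtain z where z: "z \<in> K" "(z \<in> B) \<noteq> (z \<in> C)"
    using assms(1,2) by blast
  have "C = K - B"
    using sep[OF z(1)] z assms(1,2) by auto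
  then have "card B + card C = card K"
    using assms(1,3) by (metis card_Diff_subset card_mono finite_subset le_add_diff_inverse)
  then show False
    using assms(4,5) by linarith
qed

text \<open>Turns knowledge of which transpositions stabilize a set into the separation hypothesis
  of \<open>eq_if_same_separation\<close>.\<close>

lemma transpose_image_eq_iff: "transpose x y ` B = B \<longleftrightarrow> (x \<in> B \<longleftrightarrow> y \<in> B)"
proof
  assume eq: "transpose x y ` B = B"
  have "x \<in> B \<Longrightarrow> transpose x y x \<in> B" "y \<in> B \<Longrightarrow> transpose x y y \<in> B"
    using eq by blast+
  then show "x \<in> B \<longleftrightarrow> y \<in> B"
    by auto
next
  assume "x \<in> B \<longleftrightarrow> y \<in> B"
  then show "transpose x y ` B = B"
    by (cases "x \<in> B") (auto simp: transpose_def image_iff)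
qed

text \<open>
  The parameter \<open>k\<close> is the size of the set \<open>{..<k}\<close> on which every coordinate group acts, and
  \<open>c\<close> assigns to the elements of the group \<open>G\<close> distinct subset sizes.
\<close>
locale sized_group = group G for G (structure) +
  fixes c :: "'a \<Rightarrow> nat" and k :: nat
  assumes fin: "finite (carrier G)"
    and c_inj: "inj_on c (carrier G)"
    and c_ge: "s \<in> carrier G \<Longrightarrow> 2 \<le> c s"
    and c_less: "s \<in> carrier G \<Longrightarrow> 2 * c s < k"
begin

section \<open>Base group, translations and points\<close>

text \<open>Indices outside \<open>carrier G\<close> may carry any permutation of
  \<open>{..<k}\<close>; points are empty there, so these coordinates act trivially on them.\<close>

definition base :: "('a \<Rightarrow> nat \<Rightarrow> nat) set"
  where "base = {h. \<forall>s. h s permutes {..<k}}"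

definition act :: "('a \<Rightarrow> nat \<Rightarrow> nat) \<Rightarrow> ('a \<Rightarrow> nat set) \<Rightarrow> 'a \<Rightarrow> nat set"
  where "act h f = (\<lambda>s. h s ` f s)"

text \<open>The inverse makes this a left action: the content of coordinate \<open>v\<close> moves
  to coordinate \<open>t \<otimes> v\<close>.\<close>

definition shift :: "'a \<Rightarrow> ('a \<Rightarrow> nat set) \<Rightarrow> 'a \<Rightarrow> nat set"
  where "shift t f = (\<lambda>s. if s \<in> carrier G then f (inv t \<otimes> s) else {})"

definition single :: "'a \<Rightarrow> nat \<Rightarrow> 'a \<Rightarrow> nat set"
  where "single v x = (\<lambda>s. if s = v then {x} else {})"

definition singles :: "('a \<Rightarrow> nat set) set"
  where "singles = {single v x | v x. v \<in> carrier G \<and> x < k}"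

text \<open>Letting \<open>t\<close> range over the whole group makes this set stable under
  \<open>shift u\<close>, which turns the parameter \<open>t\<close> into
  \<open>t \<otimes> inv u\<close>. Since \<open>c\<close> is injective, sizes identify indices, and
  this is what excludes permutations of the indices other than left translations.\<close>

definition patterns :: "('a \<Rightarrow> nat set) set"
  where "patterns = {f. (\<forall>s. f s \<subseteq> {..<k}) \<and> (\<forall>s. s \<notin> carrier G \<longrightarrow> f s = {}) \<and>
    (\<exists>t\<in>carrier G. \<forall>s\<in>carrier G. card (f s) = c (t \<otimes> s))}"

definition points :: "('a \<Rightarrow> nat set) set"
  where "points = singles \<union> patterns"

lemma k_gt: "4 < k"
  using c_ge[OF one_closed] c_less[OF one_closed] by linarith

lemma single_eq_iff [simp]: "single v x = single w y \<longleftrightarrow> v = w \<and> x = y"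
proof
  assume "single v x = single w y"
  then have "single v x v = single w y v" by simp
  then show "v = w \<and> x = y"
    by (auto simp: single_def split: if_splits)
qed simp

lemma act_single [simp]: "act h (single v x) = single v (h v x)"
  by (auto simp: act_def single_def fun_eq_iff)

lemma single_in_points: "v \<in> carrier G \<Longrightarrow> x < k \<Longrightarrow> single v x \<in> points"
  by (auto simp: points_def singles_def)

lemma points_subset: "f \<in> points \<Longrightarrow> f s \<subseteq> {..<k}"
  by (auto simp: points_def singles_def patterns_def single_def split: if_splits)

lemma points_outside: "f \<in> points \<Longrightarrow> s \<notin> carrier G \<Longrightarrow> f s = {}"
  by (auto simp: points_def singles_def patterns_def single_def split: if_splits)

text \<open>Supplies the bound by which \<open>eq_if_same_separation\<close> rules out complements;
  for singletons it comes from \<open>k_gt\<close>.\<close>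

lemma points_small:
  assumes "f \<in> points"
  shows "2 * card (f s) < k"
proof (cases "f \<in> patterns \<and> s \<in> carrier G")
  case True
  then obtain t where "t \<in> carrier G" "card (f s) = c (t \<otimes> s)"
    by (auto simp: patterns_def)
  then show ?thesis
    using True c_less by auto
next
  case False
  then show ?thesis
    using assms k_gt points_outside[OF assms, of s] by (auto simp: points_def singles_def single_def)
qed

lemma finite_points: "finite points"
proof (rule finite_subset)
  show "points \<subseteq> {f. \<forall>s. (s \<in> carrier G \<longrightarrow> f s \<in> Pow {..<k}) \<and> (s \<notin> carrier G \<longrightarrow> f s = {})}"
    using points_subset points_outside by (intro subsetI CollectI) blast
  show "finite \<dots>"
    using fin by (intro finite_set_of_finite_funs) auto
qed

lemma base_update: "h \<in> base \<Longrightarrow> q permutes {..<k} \<Longrightarrow> h(s := q) \<in> base"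
  by (auto simp: base_def)

lemma id_base: "(\<lambda>_. id) \<in> base"
  by (auto simp: base_def permutes_id)

lemma base_less: "h \<in> base \<Longrightarrow> h s x < k \<longleftrightarrow> x < k"
  unfolding base_def using permutes_in_image[of "h s" "{..<k}" x] by auto

lemma base_inj: "h \<in> base \<Longrightarrow> inj (h s)"
  unfolding base_def using permutes_inj by auto

text \<open>The reindexing \<open>a\<close> is there because moving \<open>shift t\<close> past an
  element of the base group permutes its coordinates; the instance arising from
  \<open>act_shift_comp\<close> is \<open>inv t \<otimes> s\<close>.\<close>

lemma base_comp:
  assumes "h \<in> base" "h' \<in> base"
  shows "(\<lambda>s. h s \<circ> h' (a s)) \<in> base"
  using assms by (auto simp: base_def intro: permutes_compose)

lemma base_inv: "h \<in> base \<Longrightarrow> (\<lambda>s. inv' (h (a s))) \<in> base"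
  by (auto simp: base_def intro: permutes_inv)

lemma act_in_points:
  assumes "h \<in> base" "f \<in> points"
  shows "act h f \<in> points"
proof (cases "f \<in> singles")
  case True
  then show ?thesis
    using assms(1) by (auto simp: singles_def intro!: single_in_points simp: base_less)
next
  case False
  then have f: "f \<in> patterns"
    using assms(2) by (simp add: points_def)
  have "card (h s ` f s) = card (f s)" for s
    using base_inj[OF assms(1)] by (metis card_image inj_on_subset subset_UNIV)
  then have "act h f \<in> patterns"
    using f base_less[OF assms(1)] unfolding patterns_def act_def by (auto simp: subset_iff)
  then show ?thesis
    by (simp add: points_def)
qed

lemma shift_single: "t \<in> carrier G \<Longrightarrow> v \<in> carrier G \<Longrightarrow> shift t (single v x) = single (t \<otimes> v) x"
  by (auto simp: shift_def single_def fun_eq_iff inv_solve_left')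

lemma shift_in_points:
  assumes t: "t \<in> carrier G" and f: "f \<in> points"
  shows "shift t f \<in> points"
proof (cases "f \<in> singles")
  case True
  then show ?thesis
    using t by (auto simp: singles_def shift_single intro!: single_in_points)
next
  case False
  then have f: "f \<in> patterns"
    using f by (simp add: points_def)
  then obtain u where u: "u \<in> carrier G" "\<forall>s\<in>carrier G. card (f s) = c (u \<otimes> s)"
    by (auto simp: patterns_def)
  then have "\<forall>s\<in>carrier G. card (shift t f s) = c ((u \<otimes> inv t) \<otimes> s)"
    using t by (auto simp: shift_def m_assoc)
  moreover have "u \<otimes> inv t \<in> carrier G"
    using t u(1) by simp
  moreover have "shift t f s \<subseteq> {..<k}" "s \<notin> carrier G \<Longrightarrow> shift t f s = {}" for s
    using f by (auto simp: patterns_def shift_def)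
  ultimately have "shift t f \<in> patterns"
    unfolding patterns_def by blast
  then show ?thesis
    by (simp add: points_def)
qed

section \<open>Double transitivity tells singletons from patterns\<close>

text \<open>On the orbit of a singleton point the base group is doubly transitive; this property
  of a point is preserved by everything normalizing the base group.\<close>
definition doubly_trans :: "('a \<Rightarrow> nat set) \<Rightarrow> bool"
  where "doubly_trans f \<longleftrightarrow> (\<forall>h1\<in>base. \<forall>h2\<in>base. act h1 f \<noteq> f \<longrightarrow> act h2 f \<noteq> f \<longrightarrow>
    (\<exists>h\<in>base. act h f = f \<and> act h (act h1 f) = act h2 f))"

text \<open>Both images of \<open>x\<close> differ from \<open>x\<close>, so the transposition
  exchanging them in coordinate \<open>v\<close> fixes \<open>x\<close>.\<close>

lemma doubly_trans_single:
  assumes "x < k"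
  shows "doubly_trans (single v x)"
  unfolding doubly_trans_def
proof (intro ballI impI)
  fix h1 h2
  assume h: "h1 \<in> base" "h2 \<in> base" "act h1 (single v x) \<noteq> single v x" "act h2 (single v x) \<noteq> single v x"
  let ?h = "(\<lambda>_. id)(v := transpose (h1 v x) (h2 v x))"
  have "?h \<in> base"
    using h assms by (intro base_update id_base permutes_swap_id) (auto simp: base_less)
  moreover have "act ?h (single v x) = single v x \<and> act ?h (act h1 (single v x)) = act h2 (single v x)"
    using h by (auto simp: transpose_def)
  ultimately show "\<exists>h\<in>base. act h (single v x) = single v x \<and> act h (act h1 (single v x)) = act h2 (single v x)"
    by blast
qed

text \<open>Let \<open>h1\<close> exchange one element of \<open>f s\<close> with an outside element
  and let \<open>h2\<close> exchange two. An element of the base group fixing \<open>f\<close>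
  preserves the size of the intersection with \<open>f s\<close>, but the two images meet
  \<open>f s\<close> in \<open>card (f s) - 1\<close> and \<open>card (f s) - 2\<close> elements.
  The bounds on \<open>c\<close> provide two elements inside and two outside.\<close>

lemma not_doubly_trans_pattern:
  assumes f: "f \<in> patterns"
  shows "\<not> doubly_trans f"
proof
  assume dt: "doubly_trans f"
  obtain s where s: "s \<in> carrier G"
    by auto
  then obtain t where t: "t \<in> carrier G" "card (f s) = c (t \<otimes> s)"
    using f by (auto simp: patterns_def)
  have sub: "f s \<subseteq> {..<k}"
    using f by (auto simp: patterns_def)
  have card: "2 \<le> card (f s)" "2 * card (f s) < k"
    using t s c_ge[of "t \<otimes> s"] c_less[of "t \<otimes> s"] by auto
  have fin_s: "finite (f s)"
    using sub finite_subset by blast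
  obtain a1 a2 where a: "a1 \<in> f s" "a2 \<in> f s" "a1 \<noteq> a2"
    using card(1) by (metis card_le_Suc0_iff_eq fin_s not_less_eq_eq numeral_2_eq_2)
  have "2 \<le> card ({..<k} - f s)"
    using card sub fin_s by (simp add: card_Diff_subset)
  then obtain b1 b2 where b: "b1 \<in> {..<k} - f s" "b2 \<in> {..<k} - f s" "b1 \<noteq> b2"
    by (metis card_le_Suc0_iff_eq finite_Diff finite_lessThan not_less_eq_eq numeral_2_eq_2)
  let ?p = "transpose a1 b1" and ?q = "transpose a1 b1 \<circ> transpose a2 b2"
  let ?h1 = "(\<lambda>_. id)(s := ?p)" and ?h2 = "(\<lambda>_. id)(s := ?q)"
  have perm: "?p permutes {..<k}" "transpose a2 b2 permutes {..<k}"
    using a b sub by (auto intro!: permutes_swap_id)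
  have h12: "?h1 \<in> base" "?h2 \<in> base"
    using perm by (auto intro!: base_update id_base intro: permutes_compose)
  have ps: "?p ` f s = insert b1 (f s - {a1})"
    using a b by (auto simp: transpose_def image_iff)
  have qs: "?q ` f s = insert b1 (insert b2 (f s - {a1, a2}))"
  proof
    show "?q ` f s \<subseteq> insert b1 (insert b2 (f s - {a1, a2}))"
      using a b by (auto simp: transpose_def)
    have "b1 = ?q a1" "b2 = ?q a2" "\<And>x. x \<in> f s - {a1, a2} \<Longrightarrow> x = ?q x"
      using a b by (auto simp: transpose_def)
    then show "insert b1 (insert b2 (f s - {a1, a2})) \<subseteq> ?q ` f s"
      using a by blast
  qed
  have "act ?h1 f s \<noteq> f s" "act ?h2 f s \<noteq> f s"
    using ps qs b by (auto simp: act_def)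
  then have "act ?h1 f \<noteq> f" "act ?h2 f \<noteq> f"
    by metis+
  then obtain h where h: "h \<in> base" "act h f = f" "act h (act ?h1 f) = act ?h2 f"
    using dt h12 unfolding doubly_trans_def by blast
  have "h s ` f s = f s" "h s ` (?p ` f s) = ?q ` f s"
    using fun_cong[OF h(2), of s] fun_cong[OF h(3), of s] by (simp_all add: act_def image_comp)
  then have "h s ` (f s \<inter> ?p ` f s) = f s \<inter> ?q ` f s"
    using base_inj[OF h(1), of s] by (simp add: image_Int)
  then have "card (f s \<inter> ?p ` f s) = card (f s \<inter> ?q ` f s)"
    by (metis base_inj[OF h(1)] card_image inj_on_subset subset_UNIV)
  moreover have "f s \<inter> ?p ` f s = f s - {a1}" "f s \<inter> ?q ` f s = f s - {a1, a2}"
    unfolding ps qs using b by auto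
  ultimately show False
    using a fin_s card by (simp add: card_Diff_subset)
qed

text \<open>Describes singletons by the action of the base group alone, hence in terms that a
  normalizing permutation respects.\<close>

lemma in_singles_iff: "f \<in> points \<Longrightarrow> f \<in> singles \<longleftrightarrow> doubly_trans f"
  using not_doubly_trans_pattern doubly_trans_single by (auto simp: points_def singles_def)

section \<open>Permutations of the points that normalize the base group\<close>

text \<open>The assumptions \<open>to\<close> and \<open>onto\<close> say that conjugation by
  \<open>g\<close> maps the permutations of the points induced by \<open>base\<close> into and onto
  themselves. The translation \<open>t\<close> records how \<open>g\<close> permutes the indices,
  and \<open>p\<close> collects the bijections it induces between coordinates.\<close>

lemma act_shift_if_normalizes:
  assumes g: "bij_betw g points points"
    and to: "\<And>h. h \<in> base \<Longrightarrow> \<exists>h'\<in>base. \<forall>f\<in>points. g (act h f) = act h' (g f)"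
    and onto: "\<And>h'. h' \<in> base \<Longrightarrow> \<exists>h\<in>base. \<forall>f\<in>points. g (act h f) = act h' (g f)"
  shows "\<exists>t\<in>carrier G. \<exists>p\<in>base. \<forall>f\<in>points. g f = act p (shift t f)"
proof -
  have g_in: "g f \<in> points" if "f \<in> points" for f
    using g that by (auto simp: bij_betw_def)
  have g_inj: "g f = g f' \<longleftrightarrow> f = f'" if "f \<in> points" "f' \<in> points" for f f'
    using g that by (meson bij_betw_def inj_on_eq_iff)
  \<comment> \<open>The two test elements are pulled back along \<open>g\<close> by
    \<open>onto\<close>, and the connecting element found for \<open>f\<close> is pushed forward by
    \<open>to\<close>.\<close>
  have "doubly_trans (g f)" if f: "f \<in> points" "doubly_trans f" for f
    unfolding doubly_trans_def
  proof (intro ballI impI)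
    fix h1' h2' assume h': "h1' \<in> base" "h2' \<in> base" "act h1' (g f) \<noteq> g f" "act h2' (g f) \<noteq> g f"
    obtain h1 h2 where h: "h1 \<in> base" "h2 \<in> base"
      "\<forall>f\<in>points. g (act h1 f) = act h1' (g f)" "\<forall>f\<in>points. g (act h2 f) = act h2' (g f)"
      using onto h'(1,2) by meson
    have "act h1 f \<noteq> f" "act h2 f \<noteq> f"
      using h(3,4) h'(3,4) f(1) by metis+
    then obtain h0 where h0: "h0 \<in> base" "act h0 f = f" "act h0 (act h1 f) = act h2 f"
      using f(2) h(1,2) unfolding doubly_trans_def by blast
    obtain h0' where h0': "h0' \<in> base" "\<forall>f\<in>points. g (act h0 f) = act h0' (g f)"
      using to h0(1) by blast
    have "act h0' (g f) = g f"
      using h0'(2) h0(2) f(1) by metis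
    moreover have "act h0' (act h1' (g f)) = act h2' (g f)"
      using h(3,4) h0'(2) h0(3) f(1) act_in_points[OF h(1) f(1)] by metis
    ultimately show "\<exists>h\<in>base. act h (g f) = g f \<and> act h (act h1' (g f)) = act h2' (g f)"
      using h0'(1) by blast
  qed

  \<comment> \<open>Induced maps on indices and coordinates\<close>
  then have singles: "g f \<in> singles" if "f \<in> singles" for f
    using that in_singles_iff g_in by (auto simp: points_def)
  then have "\<exists>w y. w \<in> carrier G \<and> y < k \<and> g (single v x) = single w y" if "v \<in> carrier G" "x < k" for v x
    using that unfolding singles_def by blast
  then obtain w \<pi> where w: "\<And>v x. v \<in> carrier G \<Longrightarrow> x < k \<Longrightarrow>
      w v x \<in> carrier G \<and> \<pi> v x < k \<and> g (single v x) = single (w v x) (\<pi> v x)"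
    by metis
  \<comment> \<open>A base element carries \<open>single v 0\<close> to \<open>single v x\<close>.
    Its conjugate under \<open>g\<close> is again in the base group, so it cannot change the index
    of the image.\<close>
  have w_const: "w v x = w v 0" if vx: "v \<in> carrier G" "x < k" for v x
  proof -
    let ?h = "(\<lambda>_. id)(v := transpose 0 x)"
    have "?h \<in> base"
      using vx by (intro base_update id_base permutes_swap_id) auto
    then obtain h' where "h' \<in> base" "\<forall>f\<in>points. g (act ?h f) = act h' (g f)"
      using to by blast
    then have "g (single v x) = act h' (g (single v 0))"
      using single_in_points[of v 0] vx by (metis act_single fun_upd_same k_gt less_nat_zero_code not_gr_zero transpose_apply_first)
    then show ?thesis
      using w[of v x] w[of v 0] vx by auto
  qed
  define \<sigma> where "\<sigma> = (\<lambda>v. w v 0)"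
  have \<sigma>: "\<sigma> v \<in> carrier G" "\<And>x. x < k \<Longrightarrow> \<pi> v x < k"
    "\<And>x. x < k \<Longrightarrow> g (single v x) = single (\<sigma> v) (\<pi> v x)" if v: "v \<in> carrier G" for v
  proof -
    show "\<sigma> v \<in> carrier G"
      using w[OF v, of 0] k_gt by (simp add: \<sigma>_def)
    show "\<pi> v x < k" "g (single v x) = single (\<sigma> v) (\<pi> v x)" if "x < k" for x
      using w[OF v that] w_const[OF v that] by (simp_all add: \<sigma>_def)
  qed
  have \<pi>_inj: "inj_on (\<pi> v) {..<k}" if "v \<in> carrier G" for v
  proof (rule inj_onI)
    fix x y assume "x \<in> {..<k}" "y \<in> {..<k}" "\<pi> v x = \<pi> v y"
    then have "g (single v x) = g (single v y)" "single v x \<in> points" "single v y \<in> points"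
      using \<sigma>(3)[OF that] single_in_points[OF that] by auto
    then show "x = y"
      using g_inj by auto
  qed
  have \<pi>_bij: "bij_betw (\<pi> v) {..<k} {..<k}" if "v \<in> carrier G" for v
    using \<pi>_inj[OF that] \<sigma>(2)[OF that]
    by (intro bij_betw_imageI endo_inj_surj) auto
  \<comment> \<open>If two indices had the same image, surjectivity of \<open>\<pi> v\<close> would
    give singletons at both with equal images under \<open>g\<close>.\<close>
  have \<sigma>_inj: "inj_on \<sigma> (carrier G)"
  proof (rule inj_onI)
    fix v v' assume v: "v \<in> carrier G" "v' \<in> carrier G" and eq: "\<sigma> v = \<sigma> v'"
    have "\<pi> v' 0 < k"
      using \<sigma>(2)[OF v(2)] k_gt by auto
    then obtain x where x: "x < k" "\<pi> v x = \<pi> v' 0"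
      using \<pi>_bij[OF v(1)] unfolding bij_betw_def by (metis imageE lessThan_iff)
    then have "g (single v x) = g (single v' 0)"
      using \<sigma>(3) v eq k_gt by auto
    then show "v = v'"
      using g_inj single_in_points v x(1) k_gt by auto
  qed
  have \<sigma>_surj: "\<sigma> ` carrier G = carrier G"
    using \<sigma>_inj \<sigma>(1) fin by (intro endo_inj_surj) auto

  \<comment> \<open>Singletons determine the action on all points\<close>
  \<comment> \<open>Conjugation by \<open>g\<close> turns the transposition of \<open>x\<close> and
    \<open>y\<close> in coordinate \<open>v\<close> into that of \<open>x'\<close> and
    \<open>y'\<close> in coordinate \<open>\<sigma> v\<close>. The first fixes \<open>f\<close>
    exactly when the second fixes \<open>g f\<close>, so \<open>\<pi> v\<close> followed by taking
    the image of \<open>f v\<close> separates the same pairs as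
    \<open>g f (\<sigma> v)\<close>.\<close>
  have g_eq: "g f (\<sigma> v) = \<pi> v ` f v" if f: "f \<in> points" and v: "v \<in> carrier G" for f v
  proof (rule sym, rule eq_if_same_separation[where K = "{..<k}"])
    show "\<pi> v ` f v \<subseteq> {..<k}"
      using points_subset[OF f, of v] \<sigma>(2)[OF v] by auto
    show "g f (\<sigma> v) \<subseteq> {..<k}"
      using points_subset[OF g_in[OF f]] by auto
    have "inj_on (\<pi> v) (f v)"
      using \<pi>_inj[OF v] points_subset[OF f] inj_on_subset by blast
    then show "2 * card (\<pi> v ` f v) < card {..<k}"
      using points_small[OF f, of v] by (simp add: card_image)
    show "2 * card (g f (\<sigma> v)) < card {..<k}"
      using points_small[OF g_in[OF f]] by simp
    fix x' y' assume "x' \<in> {..<k}" "y' \<in> {..<k}"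
    then obtain x y where xy: "x < k" "y < k" "x' = \<pi> v x" "y' = \<pi> v y"
      using \<pi>_bij[OF v] unfolding bij_betw_def by (metis imageE lessThan_iff)
    let ?h = "(\<lambda>_. id)(v := transpose x y)"
    have "?h \<in> base"
      using xy by (intro base_update id_base permutes_swap_id) auto
    then obtain h' where h': "h' \<in> base" "\<forall>f\<in>points. g (act ?h f) = act h' (g f)"
      using to by blast
    \<comment> \<open>Evaluation at singletons computes \<open>h'\<close> in every coordinate
      indexed by the group.\<close>
    have conj: "h' (\<sigma> u) (\<pi> u z) = \<pi> u (?h u z)" if "u \<in> carrier G" "z < k" for u z
    proof -
      have "?h u z < k"
        using base_less[OF \<open>?h \<in> base\<close>] that(2) by blast
      moreover have "g (act ?h (single u z)) = act h' (g (single u z))"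
        using h'(2) single_in_points[OF that] by blast
      ultimately have "single (\<sigma> u) (\<pi> u (?h u z)) = single (\<sigma> u) (h' (\<sigma> u) (\<pi> u z))"
        using \<sigma>(3)[OF that(1)] that(2) by (simp only: act_single)
      then show ?thesis
        by simp
    qed
    have h'_v: "h' (\<sigma> v) = transpose x' y'"
    proof
      fix z'
      show "h' (\<sigma> v) z' = transpose x' y' z'"
      proof (cases "z' < k")
        case True
        then obtain z where z: "z < k" "z' = \<pi> v z"
          using \<pi>_bij[OF v] unfolding bij_betw_def by (metis imageE lessThan_iff)
        have "transpose x' y' z' = \<pi> v (transpose x y z)"
          unfolding z(2) xy(3,4) using \<pi>_inj[OF v] xy(1,2) z(1)
          by (auto simp: transpose_def inj_on_eq_iff)
        then show ?thesis
          using conj[OF v z(1)] z(2) by simp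
      next
        case False
        have "h' (\<sigma> v) permutes {..<k}"
          using h'(1) by (auto simp: base_def)
        then show ?thesis
          using False xy \<sigma>(2)[OF v] by (auto simp: transpose_def permutes_def)
      qed
    qed
    have h'_u: "h' s = id" if s: "s \<in> carrier G" "s \<noteq> \<sigma> v" for s
    proof
      fix z'
      obtain u where u: "u \<in> carrier G" "s = \<sigma> u"
        using \<sigma>_surj s(1) by blast
      show "h' s z' = id z'"
      proof (cases "z' < k")
        case True
        then obtain z where z: "z < k" "z' = \<pi> u z"
          using \<pi>_bij[OF u(1)] unfolding bij_betw_def by (metis imageE lessThan_iff)
        then show ?thesis
          using conj[OF u(1) z(1)] u(2) s(2) by auto
      next
        case False
        have "h' s permutes {..<k}"
          using h'(1) by (auto simp: base_def)
        then show ?thesis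
          using False by (auto simp: permutes_def)
      qed
    qed
    have "(x \<in> f v \<longleftrightarrow> y \<in> f v) \<longleftrightarrow> act ?h f = f"
      by (auto simp: act_def fun_eq_iff transpose_image_eq_iff)
    also have "\<dots> \<longleftrightarrow> g (act ?h f) = g f"
      using g_inj act_in_points[OF \<open>?h \<in> base\<close> f] f by simp
    also have "\<dots> \<longleftrightarrow> act h' (g f) = g f"
      using h'(2) f by simp
    also have "\<dots> \<longleftrightarrow> h' (\<sigma> v) ` g f (\<sigma> v) = g f (\<sigma> v)"
    proof -
      \<comment> \<open>Outside \<open>carrier G\<close> nothing is known about \<open>h'\<close>,
        but there \<open>g f\<close> is empty.\<close>
      have "h' s ` g f s = g f s" if "s \<noteq> \<sigma> v" for s
        using h'_u[OF _ that] points_outside[OF g_in[OF f], of s] by (cases "s \<in> carrier G") auto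
      then show ?thesis
        unfolding act_def fun_eq_iff by metis
    qed
    also have "\<dots> \<longleftrightarrow> (x' \<in> g f (\<sigma> v) \<longleftrightarrow> y' \<in> g f (\<sigma> v))"
      unfolding h'_v transpose_image_eq_iff ..
    finally have "(x \<in> f v \<longleftrightarrow> y \<in> f v) \<longleftrightarrow> (x' \<in> g f (\<sigma> v) \<longleftrightarrow> y' \<in> g f (\<sigma> v))" .
    moreover have "\<pi> v z \<in> \<pi> v ` f v \<longleftrightarrow> z \<in> f v" if "z < k" for z
      using \<pi>_inj[OF v] points_subset[OF f, of v] that by (simp add: inj_on_image_mem_iff)
    ultimately show "(x' \<in> \<pi> v ` f v \<longleftrightarrow> y' \<in> \<pi> v ` f v) \<longleftrightarrow> (x' \<in> g f (\<sigma> v) \<longleftrightarrow> y' \<in> g f (\<sigma> v))"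
      using xy by simp
  qed simp

  \<comment> \<open>The index permutation is a left translation\<close>
  \<comment> \<open>A test point: the pattern with parameter \<open>\<one>\<close>, whose size at
    \<open>s\<close> is \<open>c s\<close> itself. Its image under \<open>g\<close> has size
    \<open>c v\<close> at \<open>\<sigma> v\<close>.\<close>
  define f0 where "f0 = (\<lambda>s. if s \<in> carrier G then {..<c s} else {})"
  have "c s \<le> k" if "s \<in> carrier G" for s
    using c_less[OF that] by linarith
  then have "f0 \<in> patterns"
    unfolding patterns_def f0_def by (auto intro!: bexI[of _ \<one>] dest: less_le_trans)
  then have f0: "f0 \<in> points"
    by (simp add: points_def)
  have card_gf0: "card (g f0 (\<sigma> v)) = c v" if v: "v \<in> carrier G" for v
  proof -
    have "inj_on (\<pi> v) (f0 v)"
      using \<pi>_inj[OF v] points_subset[OF f0] inj_on_subset by blast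
    then show ?thesis
      using g_eq[OF f0 v] v by (simp add: card_image f0_def)
  qed
  have "g f0 \<notin> singles"
  proof
    assume "g f0 \<in> singles"
    then have "card (g f0 (\<sigma> \<one>)) \<le> 1"
      by (auto simp: singles_def single_def)
    then show False
      using card_gf0[OF one_closed] c_ge[OF one_closed] by simp
  qed
  then obtain u where u: "u \<in> carrier G" "\<forall>s\<in>carrier G. card (g f0 s) = c (u \<otimes> s)"
    using g_in[OF f0] by (auto simp: points_def patterns_def)
  \<comment> \<open>The image of \<open>f0\<close> is a pattern with some parameter
    \<open>u\<close>, so its size at \<open>\<sigma> v\<close> is both \<open>c v\<close> and
    \<open>c (u \<otimes> \<sigma> v)\<close>; injectivity of \<open>c\<close> compares the
    arguments.\<close>
  have \<sigma>_eq: "\<sigma> v = inv u \<otimes> v" if v: "v \<in> carrier G" for v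
  proof -
    have "c (u \<otimes> \<sigma> v) = c v"
      using u card_gf0 \<sigma>(1) v by metis
    then have "u \<otimes> \<sigma> v = v"
      using c_inj u(1) \<sigma>(1)[OF v] v by (meson inj_on_eq_iff m_closed)
    then show ?thesis
      using u(1) \<sigma>(1)[OF v] v by (metis inv_solve_left)
  qed
  \<comment> \<open>Coordinate \<open>s\<close> of \<open>g f\<close> comes from coordinate
    \<open>u \<otimes> s\<close> of \<open>f\<close>, the preimage of \<open>s\<close> under
    \<open>\<sigma>\<close>. The default \<open>x\<close> makes each \<open>p s\<close> a
    permutation of \<open>{..<k}\<close>.\<close>
  define p where "p = (\<lambda>s x. if s \<in> carrier G \<and> x < k then \<pi> (u \<otimes> s) x else x)"
  have p: "p \<in> base"
    unfolding base_def
  proof (intro CollectI allI)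
    fix s
    show "p s permutes {..<k}"
    proof (cases "s \<in> carrier G")
      case True
      then have "bij_betw (p s) {..<k} {..<k}"
        using \<pi>_bij[of "u \<otimes> s"] u(1) by (subst bij_betw_cong[of _ _ "\<pi> (u \<otimes> s)"]) (auto simp: p_def)
      then show ?thesis
        by (rule bij_imp_permutes) (auto simp: p_def)
    next
      case False
      then have "p s = id"
        by (auto simp: p_def)
      then show ?thesis
        by (simp add: permutes_id)
    qed
  qed
  have "g f = act p (shift (inv u) f)" if f: "f \<in> points" for f
  proof
    fix s
    show "g f s = act p (shift (inv u) f) s"
    proof (cases "s \<in> carrier G")
      case True
      then have "s = \<sigma> (u \<otimes> s)"
        using \<sigma>_eq u(1) by (simp add: m_assoc[symmetric])
      then have "g f s = \<pi> (u \<otimes> s) ` f (u \<otimes> s)"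
        using g_eq[OF f, of "u \<otimes> s"] True u(1) by simp
      also have "\<dots> = p s ` f (u \<otimes> s)"
        using points_subset[OF f, of "u \<otimes> s"] True by (intro image_cong) (auto simp: p_def)
      finally show ?thesis
        using True u(1) by (simp add: act_def shift_def)
    next
      case False
      then show ?thesis
        using points_outside[OF g_in[OF f]] by (simp add: act_def shift_def)
    qed
  qed
  then show ?thesis
    using u(1) p by blast
qed

section \<open>Composition rules for base elements and translations\<close>

text \<open>The multiplication rule of the wreath product: a translation moved past \<open>r\<close>
  permutes the coordinates of \<open>r\<close>.\<close>

lemma act_shift_comp:
  assumes "t \<in> carrier G" "u \<in> carrier G"
  shows "act p (shift t (act r (shift u f))) = act (\<lambda>s. p s \<circ> r (inv t \<otimes> s)) (shift (t \<otimes> u) f)"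
  using assms by (auto simp: act_def shift_def fun_eq_iff image_comp inv_mult_group m_assoc)

lemma shift_one: "f \<in> points \<Longrightarrow> shift \<one> f = f"
  by (auto simp: shift_def fun_eq_iff points_outside)

text \<open>Gives both injectivity on points and the form of the inverse.\<close>

lemma act_shift_inverse:
  assumes p: "p \<in> base" and t: "t \<in> carrier G" and f: "f \<in> points"
  shows "act (\<lambda>s. inv' (p (t \<otimes> s))) (shift (inv t) (act p (shift t f))) = f"
proof -
  have "inv' (p s) \<circ> p s = id" for s
    using base_inj[OF p, of s] by simp
  then have "act (\<lambda>s. inv' (p (t \<otimes> s))) (shift (inv t) (act p (shift t f))) = shift \<one> f"
    using t act_shift_comp[of "inv t" t "\<lambda>s. inv' (p (t \<otimes> s))" p f] by (simp add: act_def)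
  then show ?thesis
    using f shift_one by simp
qed

lemma act_shift_in_points: "p \<in> base \<Longrightarrow> t \<in> carrier G \<Longrightarrow> f \<in> points \<Longrightarrow> act p (shift t f) \<in> points"
  by (simp add: act_in_points shift_in_points)

text \<open>The singleton at \<open>\<one>\<close> is sent to one at index \<open>t\<close>, from
  which \<open>t\<close> can be read off.\<close>

lemma act_shift_unique:
  assumes "t \<in> carrier G" "u \<in> carrier G"
    and eq: "\<And>f. f \<in> points \<Longrightarrow> act p (shift t f) = act r (shift u f)"
  shows "t = u"
  using assms(1,2) eq[OF single_in_points[of \<one> 0]] k_gt by (simp add: shift_single)

section \<open>Transfer to the symmetric group\<close>

text \<open>Unfolds the normalizer, a stabilizer for conjugation of subsets by cosets, into
  composition of functions.\<close>

lemma normalizer_sym_group_iff: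
  assumes H: "H \<subseteq> carrier (sym_group n)"
  shows "q \<in> normalizer (sym_group n) H \<longleftrightarrow> q permutes {1..n} \<and> (\<lambda>h. q \<circ> h \<circ> inv' q) ` H = H"
proof (cases "q permutes {1..n}")
  case True
  then have "q <#\<^bsub>sym_group n\<^esub> H #>\<^bsub>sym_group n\<^esub> inv\<^bsub>sym_group n\<^esub> q = (\<lambda>h. q \<circ> h \<circ> inv' q) ` H"
    by (auto simp: l_coset_def r_coset_def sym_group_carrier sym_group_mult image_def)
  then show ?thesis
    using True H by (simp add: normalizer_def stabilizer_def sym_group_carrier)
qed (simp add: normalizer_def stabilizer_def sym_group_carrier)

lemma normalizer_quotient_sym_group: "\<exists>n::nat. normalizer_quotient G (sym_group n)"
proof -
  define n where "n = card points"
  let ?I = "{1..n}" and ?S = "sym_group n"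
  interpret S: group ?S
    by (rule sym_group_is_group)
  obtain \<omega> where \<omega>: "bij_betw \<omega> ?I points"
    using finite_points unfolding n_def by (metis bij_betw_iff_card card_atLeastAtMost diff_Suc_1 finite_atLeastAtMost)
  have \<omega>_in: "\<omega> i \<in> points" if "i \<in> ?I" for i
    using \<omega> that by (auto simp: bij_betw_def)
  have \<omega>_inj: "\<omega> i = \<omega> j \<longleftrightarrow> i = j" if "i \<in> ?I" "j \<in> ?I" for i j
    using \<omega> that by (meson bij_betw_def inj_on_eq_iff)
  have \<omega>_surj: "\<exists>i\<in>?I. f = \<omega> i" if "f \<in> points" for f
    using \<omega> that by (auto simp: bij_betw_def)

  \<comment> \<open>Relating permutations to group elements\<close>
  \<comment> \<open>Read through the numbering \<open>\<omega>\<close>, \<open>q\<close> acts as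
    translation by \<open>t\<close> followed by a base element. \<open>R\<close> will be the graph
    of a homomorphism onto \<open>G\<close>.\<close>
  define R where "R = (\<lambda>q t. q permutes ?I \<and> t \<in> carrier G \<and>
    (\<exists>p\<in>base. \<forall>i\<in>?I. \<omega> (q i) = act p (shift t (\<omega> i))))"
  have R_carrier: "R q t \<Longrightarrow> q permutes ?I" "R q t \<Longrightarrow> t \<in> carrier G" for q t
    by (auto simp: R_def)
  have R_comp: "R (q \<circ> q') (t \<otimes> t')" if R: "R q t" "R q' t'" for q q' t t'
  proof -
    obtain p p' where p: "p \<in> base" "\<forall>i\<in>?I. \<omega> (q i) = act p (shift t (\<omega> i))"
        "p' \<in> base" "\<forall>i\<in>?I. \<omega> (q' i) = act p' (shift t' (\<omega> i))"
      using R unfolding R_def by blast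
    have "\<omega> ((q \<circ> q') i) = act (\<lambda>s. p s \<circ> p' (inv t \<otimes> s)) (shift (t \<otimes> t') (\<omega> i))" if "i \<in> ?I" for i
    proof -
      have "q' i \<in> ?I"
        using R_carrier(1)[OF R(2)] that by (simp only: permutes_in_image)
      then show ?thesis
        using p that R_carrier(2)[OF R(1)] R_carrier(2)[OF R(2)]
        by (simp del: atLeastAtMost_iff add: act_shift_comp)
    qed
    then show ?thesis
      unfolding R_def using R_carrier[OF R(1)] R_carrier[OF R(2)] base_comp[OF p(1,3)]
      by (blast intro: permutes_compose m_closed)
  qed
  \<comment> \<open>The translation \<open>shift t\<close> itself serves, with trivial base
    part.\<close>
  have R_ex: "\<exists>q. R q t" if t: "t \<in> carrier G" for t
  proof -
    have "\<exists>j\<in>?I. \<omega> j = shift t (\<omega> i)" if "i \<in> ?I" for i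
      using \<omega>_surj[OF shift_in_points[OF t \<omega>_in[OF that]]] by metis
    then obtain j where j: "\<And>i. i \<in> ?I \<Longrightarrow> j i \<in> ?I \<and> \<omega> (j i) = shift t (\<omega> i)"
      by metis
    have act_id: "act (\<lambda>_. id) f = f" for f
      by (simp add: act_def)
    have "inj_on j ?I"
    proof (rule inj_onI)
      fix a b assume ab: "a \<in> ?I" "b \<in> ?I" "j a = j b"
      then have "shift t (\<omega> a) = shift t (\<omega> b)"
        using j by metis
      then have "\<omega> a = \<omega> b"
        using act_shift_inverse[OF id_base t] \<omega>_in ab(1,2) by (metis act_id)
      then show "a = b"
        using \<omega>_inj ab(1,2) by blast
    qed
    then have "bij_betw j ?I ?I"
      using j by (intro bij_betw_imageI endo_inj_surj) auto
    then have "bij_betw (\<lambda>i. if i \<in> ?I then j i else i) ?I ?I"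
      by (subst bij_betw_cong[where g = j]) auto
    then have "(\<lambda>i. if i \<in> ?I then j i else i) permutes ?I"
      by (rule bij_imp_permutes) (simp del: atLeastAtMost_iff)
    moreover have "\<forall>i\<in>?I. \<omega> (if i \<in> ?I then j i else i) = act (\<lambda>_. id) (shift t (\<omega> i))"
      using j act_id by (simp del: atLeastAtMost_iff)
    ultimately show ?thesis
      unfolding R_def using t id_base by blast
  qed
  have R_unique: "t = u" if R: "R q t" "R q u" for q t u
  proof -
    obtain p r where "\<forall>i\<in>?I. \<omega> (q i) = act p (shift t (\<omega> i))" "\<forall>i\<in>?I. \<omega> (q i) = act r (shift u (\<omega> i))"
      using R unfolding R_def by blast
    then have "act p (shift t f) = act r (shift u f)" if "f \<in> points" for f
      using \<omega>_surj[OF that] by metis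
    then show ?thesis
      using act_shift_unique R_carrier(2)[OF R(1)] R_carrier(2)[OF R(2)] by blast
  qed
  have R_id: "R id \<one>"
    unfolding R_def using id_base \<omega>_in shift_one
    by (auto simp: permutes_id act_def intro!: bexI[of _ "\<lambda>_. id"])
  have R_inv: "R (inv' q) (inv t)" if R: "R q t" for q t
  proof -
    obtain p where p: "p \<in> base" "\<forall>i\<in>?I. \<omega> (q i) = act p (shift t (\<omega> i))"
      using R unfolding R_def by blast
    have "\<omega> (inv' q i) = act (\<lambda>s. inv' (p (t \<otimes> s))) (shift (inv t) (\<omega> i))" if "i \<in> ?I" for i
    proof -
      have i: "inv' q i \<in> ?I" "q (inv' q i) = i"
        using R_carrier(1)[OF R] that by (simp_all only: permutes_inv permutes_in_image permutes_inverses)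
      show ?thesis
        using act_shift_inverse[OF p(1) R_carrier(2)[OF R] \<omega>_in[OF i(1)]] p(2) i by metis
    qed
    then show ?thesis
      unfolding R_def using R_carrier[OF R] p(1) base_inv permutes_inv by blast
  qed

  \<comment> \<open>The subgroup and its normalizer\<close>
  \<comment> \<open>\<open>H\<close> is the base group acting on the numbered points, and
    \<open>N\<close> is the candidate for its normalizer.\<close>
  define H where "H = {q. R q \<one>}"
  define N where "N = {q. \<exists>t. R q t}"
  have H_sub: "subgroup H ?S"
  proof (rule S.subgroupI)
    show "H \<subseteq> carrier ?S" "H \<noteq> {}"
      using R_carrier R_id by (auto simp: H_def sym_group_carrier)
    show "inv\<^bsub>?S\<^esub> a \<in> H" if "a \<in> H" for a
      using R_inv[of a \<one>] R_carrier(1)[of a] that by (simp add: H_def sym_group_carrier)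
    show "a \<otimes>\<^bsub>?S\<^esub> b \<in> H" if "a \<in> H" "b \<in> H" for a b
      using R_comp[of a \<one> b \<one>] that by (simp add: H_def sym_group_mult)
  qed
  have N_sub: "subgroup N ?S"
  proof (rule S.subgroupI)
    show "N \<subseteq> carrier ?S" "N \<noteq> {}"
      using R_carrier R_id by (auto simp: N_def sym_group_carrier)
    show "inv\<^bsub>?S\<^esub> a \<in> N" if a: "a \<in> N" for a
    proof -
      obtain t where "R a t"
        using a by (auto simp: N_def)
      then show ?thesis
        using R_inv R_carrier(1) by (auto simp: N_def sym_group_carrier)
    qed
    show "a \<otimes>\<^bsub>?S\<^esub> b \<in> N" if "a \<in> N" "b \<in> N" for a b
      using R_comp that by (simp add: N_def sym_group_mult) blast
  qed
  have H_perm: "H \<subseteq> carrier ?S"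
    using H_sub subgroup.subset by blast
  \<comment> \<open>The group element attached to the conjugate is
    \<open>t \<otimes> \<one> \<otimes> inv t\<close>, which is \<open>\<one>\<close>.\<close>
  have conj_H: "q \<circ> h \<circ> inv' q \<in> H" if "R q t" "h \<in> H" for q h t
  proof -
    have "R (q \<circ> h \<circ> inv' q) (t \<otimes> \<one> \<otimes> inv t)"
      using that by (intro R_comp R_inv) (simp_all add: H_def)
    then show ?thesis
      using R_carrier(2)[OF that(1)] by (simp add: H_def)
  qed
  have "normalizer ?S H = N"
  proof (intro equalityI subsetI)
    fix q assume "q \<in> N"
    then obtain t where t: "R q t"
      by (auto simp: N_def)
    have q: "q permutes ?I"
      using t R_carrier by blast
    \<comment> \<open>Conjugation by the inverse of \<open>q\<close> also maps \<open>H\<close> into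
      itself, which yields the reverse inclusion.\<close>
    have "h \<in> (\<lambda>h. q \<circ> h \<circ> inv' q) ` H" if "h \<in> H" for h
    proof
      show "inv' q \<circ> h \<circ> q \<in> H"
        using conj_H[OF R_inv[OF t] that] q by (simp add: permutes_inv_inv)
      show "h = q \<circ> (inv' q \<circ> h \<circ> q) \<circ> inv' q"
        using q by (simp add: fun_eq_iff permutes_inverses)
    qed
    then have "(\<lambda>h. q \<circ> h \<circ> inv' q) ` H = H"
      using conj_H[OF t] by auto
    then show "q \<in> normalizer ?S H"
      using q H_perm by (simp add: normalizer_sym_group_iff)
  next
    fix q assume "q \<in> normalizer ?S H"
    then have q: "q permutes ?I" "(\<lambda>h. q \<circ> h \<circ> inv' q) ` H = H"
      using H_perm by (simp_all add: normalizer_sym_group_iff)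
    have q_in: "q i \<in> ?I" if "i \<in> ?I" for i
      using q(1) that by (simp only: permutes_in_image)
    define \<iota> where "\<iota> = inv_into ?I \<omega>"
    have \<iota>: "\<iota> f \<in> ?I" "\<omega> (\<iota> f) = f" if "f \<in> points" for f
      using \<omega> that unfolding \<iota>_def
      by (metis bij_betw_def inv_into_into, metis bij_betw_inv_into_right)
    have \<iota>\<omega>: "\<iota> (\<omega> i) = i" if "i \<in> ?I" for i
      using \<omega> that unfolding \<iota>_def by (metis bij_betw_inv_into_left)
    \<comment> \<open>\<open>g\<close> is \<open>q\<close> transported to the points, so that
      \<open>act_shift_if_normalizes\<close> applies to it.\<close>
    define g where "g = \<omega> \<circ> q \<circ> \<iota>"
    have g_bij: "bij_betw g points points"
      unfolding g_def \<iota>_def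
      using bij_betw_trans[OF bij_betw_inv_into[OF \<omega>] bij_betw_trans[OF permutes_imp_bij[OF q(1)] \<omega>]]
      by (simp only: comp_assoc)
    \<comment> \<open>Together with \<open>H_base\<close>, this passes between \<open>H\<close> and
      the base group in both directions.\<close>
    have base_perm: "\<exists>h\<in>H. \<forall>i\<in>?I. \<omega> (h i) = act p (\<omega> i)" if p: "p \<in> base" for p
    proof -
      define h where "h = (\<lambda>i. if i \<in> ?I then \<iota> (act p (\<omega> i)) else i)"
      have act_p: "act p (\<omega> i) \<in> points" if "i \<in> ?I" for i
        using act_in_points[OF p \<omega>_in[OF that]] .
      have h: "h i \<in> ?I" "\<omega> (h i) = act p (\<omega> i)" if "i \<in> ?I" for i
        using \<iota>[OF act_p[OF that]] that by (simp_all add: h_def)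
      have "inj_on h ?I"
      proof (rule inj_onI)
        fix a b assume ab: "a \<in> ?I" "b \<in> ?I" "h a = h b"
        then have "act p (shift \<one> (\<omega> a)) = act p (shift \<one> (\<omega> b))"
          using h(2) \<omega>_in shift_one by metis
        then have "\<omega> a = \<omega> b"
          using act_shift_inverse[OF p one_closed] \<omega>_in ab(1,2) by metis
        then show "a = b"
          using \<omega>_inj ab(1,2) by blast
      qed
      then have "bij_betw h ?I ?I"
        using h(1) by (intro bij_betw_imageI endo_inj_surj) auto
      then have "h permutes ?I"
        by (rule bij_imp_permutes) (auto simp: h_def)
      moreover have "\<forall>i\<in>?I. \<omega> (h i) = act p (shift \<one> (\<omega> i))"
        using h(2) \<omega>_in shift_one by metis
      ultimately have "h \<in> H"
        unfolding H_def R_def using p by blast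
      then show ?thesis
        using h(2) by blast
    qed
    have H_base: "\<exists>p\<in>base. \<forall>i\<in>?I. \<omega> (h i) = act p (\<omega> i)" if h: "h \<in> H" for h
    proof -
      obtain p where p: "p \<in> base" "\<forall>i\<in>?I. \<omega> (h i) = act p (shift \<one> (\<omega> i))"
        using h unfolding H_def R_def by blast
      then have "\<forall>i\<in>?I. \<omega> (h i) = act p (\<omega> i)"
        using shift_one[OF \<omega>_in] by (simp del: atLeastAtMost_iff)
      then show ?thesis
        using p(1) by blast
    qed
    \<comment> \<open>The identity \<open>h' \<circ> q = q \<circ> h\<close>, read on
      points.\<close>
    have transfer: "\<forall>f\<in>points. g (act p f) = act p' (g f)"
      if "\<forall>i\<in>?I. \<omega> (h i) = act p (\<omega> i)" "\<forall>i\<in>?I. \<omega> (h' i) = act p' (\<omega> i)"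
        "h' = q \<circ> h \<circ> inv' q" "h \<in> H" for p p' h h'
    proof
      fix f assume f: "f \<in> points"
      have "h permutes ?I"
        using that(4) R_carrier(1) by (auto simp: H_def)
      then have h_in: "h (\<iota> f) \<in> ?I"
        using \<iota>(1)[OF f] by (simp only: permutes_in_image)
      have "act p f = \<omega> (h (\<iota> f))"
        using that(1) \<iota>[OF f] by metis
      then have "g (act p f) = \<omega> (q (h (\<iota> f)))"
        using \<iota>\<omega>[OF h_in] by (simp add: g_def)
      also have "\<dots> = \<omega> (h' (q (\<iota> f)))"
        using that(3) q(1) by (simp add: permutes_inverses)
      also have "\<dots> = act p' (g f)"
        using that(2) q_in[OF \<iota>(1)[OF f]] by (simp only: g_def comp_apply)
      finally show "g (act p f) = act p' (g f)" .
    qed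
    have "\<exists>t\<in>carrier G. \<exists>p\<in>base. \<forall>f\<in>points. g f = act p (shift t f)"
    proof (rule act_shift_if_normalizes[OF g_bij])
      fix p assume "p \<in> base"
      then obtain h where h: "h \<in> H" "\<forall>i\<in>?I. \<omega> (h i) = act p (\<omega> i)"
        using base_perm by blast
      then have "q \<circ> h \<circ> inv' q \<in> H"
        using q(2) by blast
      then show "\<exists>p'\<in>base. \<forall>f\<in>points. g (act p f) = act p' (g f)"
        using H_base transfer[OF h(2) _ refl h(1)] by blast
    next
      fix p' assume "p' \<in> base"
      then obtain h' where h': "h' \<in> H" "\<forall>i\<in>?I. \<omega> (h' i) = act p' (\<omega> i)"
        using base_perm by blast
      then obtain h where h: "h \<in> H" "h' = q \<circ> h \<circ> inv' q"
        using q(2) by blast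
      then show "\<exists>p\<in>base. \<forall>f\<in>points. g (act p f) = act p' (g f)"
        using H_base[OF h(1)] transfer[OF _ h'(2) h(2,1)] by blast
    qed
    then obtain t p where tp: "t \<in> carrier G" "p \<in> base" "\<forall>f\<in>points. g f = act p (shift t f)"
      by blast
    have "\<omega> (q i) = act p (shift t (\<omega> i))" if "i \<in> ?I" for i
      using tp(3) \<omega>_in[OF that] \<iota>\<omega>[OF that] by (metis comp_apply g_def)
    then show "q \<in> N"
      unfolding N_def R_def using q(1) tp(1,2) by blast
  qed

  \<comment> \<open>The quotient by the first isomorphism theorem\<close>
  moreover have "(?S\<lparr>carrier := N\<rparr>) Mod H \<cong> G"
  proof -
    \<comment> \<open>Well defined on \<open>N\<close> by \<open>R_unique\<close>; its kernel is
      \<open>H\<close>, and it is surjective by \<open>R_ex\<close>.\<close>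
    define \<tau> where "\<tau> = (\<lambda>q. THE t. R q t)"
    have \<tau>: "\<tau> q = t" if "R q t" for q t
      unfolding \<tau>_def using that R_unique by blast
    have \<tau>_R: "R q (\<tau> q)" if "q \<in> N" for q
      using that \<tau> by (auto simp: N_def)
    have "group_hom (?S\<lparr>carrier := N\<rparr>) G \<tau>"
    proof (intro group_hom.intro group_hom_axioms.intro homI)
      show "group (?S\<lparr>carrier := N\<rparr>)"
        using N_sub S.subgroup_imp_group by blast
      show "group G"
        by (rule group_axioms)
      show "\<tau> q \<in> carrier G" if "q \<in> carrier (?S\<lparr>carrier := N\<rparr>)" for q
        using R_carrier(2)[OF \<tau>_R] that by simp
      show "\<tau> (q \<otimes>\<^bsub>?S\<lparr>carrier := N\<rparr>\<^esub> q') = \<tau> q \<otimes> \<tau> q'"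
        if "q \<in> carrier (?S\<lparr>carrier := N\<rparr>)" "q' \<in> carrier (?S\<lparr>carrier := N\<rparr>)" for q q'
        using \<tau>[OF R_comp[OF \<tau>_R \<tau>_R]] that by (simp add: sym_group_mult)
    qed
    moreover have "\<tau> ` carrier (?S\<lparr>carrier := N\<rparr>) = carrier G"
    proof
      show "\<tau> ` carrier (?S\<lparr>carrier := N\<rparr>) \<subseteq> carrier G"
        using R_carrier(2)[OF \<tau>_R] by auto
      show "carrier G \<subseteq> \<tau> ` carrier (?S\<lparr>carrier := N\<rparr>)"
      proof
        fix t assume "t \<in> carrier G"
        then obtain q where "R q t"
          using R_ex by blast
        then show "t \<in> \<tau> ` carrier (?S\<lparr>carrier := N\<rparr>)"
          using \<tau> by (intro image_eqI[of _ _ q]) (auto simp: N_def)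
      qed
    qed
    moreover have "kernel (?S\<lparr>carrier := N\<rparr>) G \<tau> = H"
      using \<tau> \<tau>_R by (fastforce simp: kernel_def H_def N_def)
    ultimately show ?thesis
      using group_hom.FactGroup_iso by metis
  qed
  ultimately have "normalizer_quotient G ?S"
    unfolding normalizer_quotient_def using H_sub by metis
  then show ?thesis ..
qed

end

section \<open>Choice of the sizes\<close>

theorem theorem1:
  fixes T :: "('a, 'b) monoid_scheme"
  assumes "group T" and "finite (carrier T)"
  shows "\<exists>n::nat. normalizer_quotient T (sym_group n)"
proof -
  let ?m = "card (carrier T)"
  obtain e where e: "bij_betw e (carrier T) {0..<?m}"
    using ex_bij_betw_finite_nat[OF assms(2)] by blast
  have "e s < ?m" if "s \<in> carrier T" for s
    using e that by (force simp: bij_betw_def)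
  moreover have "inj_on (\<lambda>s. e s + 2) (carrier T)"
    using e by (auto simp: bij_betw_def inj_on_def)
  \<comment> \<open>As \<open>e\<close> takes values below \<open>?m\<close>, the sizes lie between
    \<open>2\<close> and \<open>?m + 1\<close>, so their doubles are at most
    \<open>2 * ?m + 2\<close>.\<close>
  ultimately have "sized_group T (\<lambda>s. e s + 2) (2 * ?m + 3)"
    using assms by (fastforce simp: sized_group_def sized_group_axioms_def)
  then show ?thesis
    by (rule sized_group.normalizer_quotient_sym_group)
qed

end
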